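(* Let $n\ge 1$. For any $f(\xi,z)\in\mathbb{C}[\xi,z]$, one has $f(\xi,z)\in\operatorname{Im}\Theta$ if and only if the $\xi^{[-1]}\mathbb{C}[\xi^{-1}]$-part of its Laplace transformation $\mathcal{L}(f)(\xi)$ is equal to zero.
   Context: Here $z=(z_1,\dots,z_n)$ and $\xi=(\xi_1,\dots,\xi_n)$ are commuting free variables and $\partial_i:=\partial/\partial z_i$. Put $\Theta_i:=\xi_i-\partial_i$ ($1\le i\le n$), a differential operator of $\mathbb{C}[\xi,z]$, $\Theta:=\{\Theta_1,\dots,\Theta_n\}$, and $\operatorname{Im}\Theta:=\sum_{i=1}^n\Theta_i(\mathbb{C}[\xi,z])$. The (multidimensional) Laplace transformation of $f(\xi,z)\in\mathbb{C}[\xi,z]$ is $\mathcal{L}(f)(\xi):=\int_{(\mathbb{R}^+)^n}f(\xi,z)e^{-\xi z}\,dz$ for $\xi\in(\mathbb{R}^+)^n$, where $\mathbb{R}^+$ is the set of positive reals and $\xi z=\sum_{i=1}^n\xi_iz_i$; it is a Laurent polynomial in $\xi_1,\dots,\xi_n$. Write $\xi^{[-1]}:=\prod_{i=1}^n\xi_i^{-1}$ and $\mathbb{C}[\xi^{-1}]=\mathbb{C}[\xi_1^{-1},\dots,\xi_n^{-1}]$. For a Laurent polynomial $p(\xi)$, its $\xi^{[-1]}\mathbb{C}[\xi^{-1}]$-part is zero if the coefficient of $\xi^\alpha$ in $p$ is zero for every $\alpha\in\mathbb{Z}^n$ with $\xi^\alpha\in\xi^{[-1]}\mathbb{C}[\xi^{-1}]$,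 i.e. for every $\alpha$ all of whose components are $\le -1$. *)

theory Defs
  imports "HOL-Analysis.Analysis" "HOL-Library.Poly_Mapping"
begin

section \<open>Polynomials in \<open>\<xi>\<close> and \<open>z\<close>\<close>

text \<open>
  Multivariate polynomials are finitely supported maps from exponent vectors to coefficients,
  with the convolution ring structure of \<open>Poly_Mapping\<close>.  The index set of the variables is a
  type \<open>'n\<close> (assumed finite below), so that \<open>n\<close> is \<open>CARD('n)\<close>, which is positive.
\<close>

datatype 'n var = Xi 'n | Zv 'n

type_synonym 'n xz_poly = "('n var \<Rightarrow>\<^sub>0 nat) \<Rightarrow>\<^sub>0 complex"

type_synonym 'n laurent_poly = "('n \<Rightarrow>\<^sub>0 int) \<Rightarrow>\<^sub>0 complex"

definition xz_var :: "'n var \<Rightarrow> 'n xz_poly" where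
  "xz_var v = Poly_Mapping.single (Poly_Mapping.single v 1) 1"

text \<open>
  The subtraction of exponents below is truncated, but whenever it is not exact the coefficient
  is multiplied by \<open>0\<close>.
\<close>

definition partial_deriv :: "'n var \<Rightarrow> 'n xz_poly \<Rightarrow> 'n xz_poly" where
  "partial_deriv v p =
     (\<Sum>m\<in>Poly_Mapping.keys p.
        Poly_Mapping.single (m - Poly_Mapping.single v 1)
          (of_nat (Poly_Mapping.lookup m v) * Poly_Mapping.lookup p m))"

definition Theta :: "'n \<Rightarrow> 'n xz_poly \<Rightarrow> 'n xz_poly" where
  "Theta i p = xz_var (Xi i) * p - partial_deriv (Zv i) p"

definition Im_Theta :: "('n::finite) xz_poly set" where
  "Im_Theta = {\<Sum>i\<in>UNIV. Theta i (g i) | g. True}"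

section \<open>Laplace transformation\<close>

definition poly_eval :: "'n xz_poly \<Rightarrow> ('n var \<Rightarrow> complex) \<Rightarrow> complex" where
  "poly_eval p x =
     (\<Sum>m\<in>Poly_Mapping.keys p.
        Poly_Mapping.lookup p m * (\<Prod>v\<in>Poly_Mapping.keys m. x v ^ Poly_Mapping.lookup m v))"

definition xz_point :: "real^'n \<Rightarrow> real^'n \<Rightarrow> 'n var \<Rightarrow> complex" where
  "xz_point \<xi> z v = (case v of Xi i \<Rightarrow> of_real (\<xi> $ i) | Zv i \<Rightarrow> of_real (z $ i))"

definition pos_orthant :: "(real^'n) set" where
  "pos_orthant = {x. \<forall>i. 0 < x $ i}"

definition laplace :: "('n::finite) xz_poly \<Rightarrow> real^'n \<Rightarrow> complex" where
  "laplace f \<xi> =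
     (LINT z:pos_orthant|lborel. poly_eval f (xz_point \<xi> z) * of_real (exp (- (\<xi> \<bullet> z))))"

definition laurent_eval :: "('n::finite) laurent_poly \<Rightarrow> real^'n \<Rightarrow> complex" where
  "laurent_eval p \<xi> =
     (\<Sum>\<alpha>\<in>Poly_Mapping.keys p.
        Poly_Mapping.lookup p \<alpha> * (\<Prod>i\<in>UNIV. of_real (\<xi> $ i) powi Poly_Mapping.lookup \<alpha> i))"

text \<open>
  The function \<open>laplace f\<close> on the positive orthant is given by exactly one Laurent polynomial,
  see \<open>ex1_laplace_laurent\<close>.
\<close>

definition laplace_laurent :: "('n::finite) xz_poly \<Rightarrow> 'n laurent_poly" where
  "laplace_laurent f = (THE p. \<forall>\<xi>\<in>pos_orthant. laurent_eval p \<xi> = laplace f \<xi>)"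

definition negative_part_zero :: "'n laurent_poly \<Rightarrow> bool" where
  "negative_part_zero p \<longleftrightarrow>
     (\<forall>\<alpha>. (\<forall>i. Poly_Mapping.lookup \<alpha> i \<le> -1) \<longrightarrow> Poly_Mapping.lookup p \<alpha> = 0)"

section \<open>The Laplace transform is a unique Laurent polynomial\<close>

definition lmono :: "('n::finite \<Rightarrow>\<^sub>0 int) \<Rightarrow> real^'n \<Rightarrow> complex" where
  "lmono \<alpha> \<xi> = (\<Prod>i\<in>UNIV. of_real (\<xi> $ i) powi Poly_Mapping.lookup \<alpha> i)"

lemma lmono_indep:
  assumes "finite S" "\<And>\<xi>. \<xi> \<in> pos_orthant \<Longrightarrow> (\<Sum>\<alpha>\<in>S. c \<alpha> * lmono \<alpha> \<xi>) = 0" "\<alpha> \<in> S"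
  shows "c \<alpha> = 0"
  using assms
proof (induction S arbitrary: c \<alpha> rule: finite_induct)
  case empty
  then show ?case by simp
next
  case (insert \<beta> S)
  have S0: "c \<gamma> = 0" if g: "\<gamma> \<in> S" for \<gamma>
  proof -
    from g insert.hyps have "\<gamma> \<noteq> \<beta>" by auto
    then obtain i where i: "Poly_Mapping.lookup \<gamma> i \<noteq> Poly_Mapping.lookup \<beta> i"
      by (metis poly_mapping_eqI)
    define e :: "('a \<Rightarrow>\<^sub>0 int) \<Rightarrow> complex" where "e = (\<lambda>\<alpha>. 2 powi Poly_Mapping.lookup \<alpha> i)"
    have "c \<gamma> * (e \<gamma> - e \<beta>) = 0"
    proof (rule insert.IH[where c = "\<lambda>\<alpha>. c \<alpha> * (e \<alpha> - e \<beta>)"])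
      fix \<xi> :: "real^'a" assume x: "\<xi> \<in> pos_orthant"
      define \<eta> :: "real^'a" where "\<eta> = (\<chi> j. (if j = i then 2 else 1) * \<xi> $ j)"
      have y: "\<eta> \<in> pos_orthant" using x by (auto simp: \<eta>_def pos_orthant_def)
      have m: "lmono \<alpha> \<eta> = e \<alpha> * lmono \<alpha> \<xi>" for \<alpha>
      proof -
        have "lmono \<alpha> \<eta> = (\<Prod>j\<in>UNIV. (if j = i then e \<alpha> else 1)
                 * of_real (\<xi> $ j) powi Poly_Mapping.lookup \<alpha> j)"
          unfolding lmono_def
          by (intro prod.cong) (auto simp: \<eta>_def e_def power_int_mult_distrib)
        also have "\<dots> = e \<alpha> * lmono \<alpha> \<xi>"
          by (simp add: prod.distrib lmono_def)
        finally show ?thesis .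
      qed
      have "(\<Sum>\<alpha>\<in>insert \<beta> S. c \<alpha> * lmono \<alpha> \<eta>) - e \<beta> * (\<Sum>\<alpha>\<in>insert \<beta> S. c \<alpha> * lmono \<alpha> \<xi>) = 0"
        using insert.prems(1)[OF x] insert.prems(1)[OF y] by simp
      then have "(\<Sum>\<alpha>\<in>insert \<beta> S. c \<alpha> * (e \<alpha> - e \<beta>) * lmono \<alpha> \<xi>) = 0"
        by (simp only: m sum_distrib_left sum_subtractf[symmetric]) (simp only: algebra_simps)
      then show "(\<Sum>\<alpha>\<in>S. c \<alpha> * (e \<alpha> - e \<beta>) * lmono \<alpha> \<xi>) = 0"
        using insert.hyps by simp
    qed (rule g)
    moreover have "e \<gamma> \<noteq> e \<beta>"
    proof
      assume "e \<gamma> = e \<beta>"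
      then have "norm (e \<gamma>) = norm (e \<beta>)" by simp
      then have "(2::real) powi Poly_Mapping.lookup \<gamma> i = 2 powi Poly_Mapping.lookup \<beta> i"
        by (simp add: e_def norm_power_int)
      then show False using i
        by (metis linorder_neqE power_int_strict_increasing less_irrefl one_less_numeral_iff
              semiring_norm(76))
    qed
    ultimately show ?thesis by simp
  qed
  define o1 :: "real^'a" where "o1 = (\<chi> i. 1)"
  have "(\<Sum>\<alpha>\<in>insert \<beta> S. c \<alpha> * lmono \<alpha> o1) = 0"
    by (rule insert.prems(1)) (simp add: o1_def pos_orthant_def)
  then have "c \<beta> = 0"
    using insert.hyps S0 by (simp add: lmono_def o1_def)
  with S0 insert.prems(2) show ?case by auto
qed

lemma laurent_eval_superset:
  assumes "finite S" "Poly_Mapping.keys p \<subseteq> S"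
  shows "laurent_eval p \<xi> = (\<Sum>\<alpha>\<in>S. Poly_Mapping.lookup p \<alpha> * lmono \<alpha> \<xi>)"
  unfolding laurent_eval_def lmono_def[symmetric] using assms
  by (intro sum.mono_neutral_left) (auto simp: in_keys_iff)

lemma laurent_eval_eqD:
  assumes "\<And>\<xi>. \<xi> \<in> pos_orthant \<Longrightarrow> laurent_eval p \<xi> = laurent_eval q \<xi>"
  shows "p = q"
proof (rule poly_mapping_eqI)
  fix \<alpha>
  let ?S = "insert \<alpha> (Poly_Mapping.keys p \<union> Poly_Mapping.keys q)"
  have "Poly_Mapping.lookup p \<alpha> - Poly_Mapping.lookup q \<alpha> = 0"
  proof (rule lmono_indep[where S = ?S
          and c = "\<lambda>\<alpha>. Poly_Mapping.lookup p \<alpha> - Poly_Mapping.lookup q \<alpha>"])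
    fix \<xi> :: "real^'a" assume "\<xi> \<in> pos_orthant"
    from assms[OF this]
    show "(\<Sum>\<alpha>\<in>?S. (Poly_Mapping.lookup p \<alpha> - Poly_Mapping.lookup q \<alpha>) * lmono \<alpha> \<xi>) = 0"
      by (subst (asm) (1 2) laurent_eval_superset[where S = ?S])
         (auto simp: algebra_simps sum_subtractf)
  qed auto
  then show "Poly_Mapping.lookup p \<alpha> = Poly_Mapping.lookup q \<alpha>" by simp
qed

lemma laurent_eval_add: "laurent_eval (p + q) \<xi> = laurent_eval p \<xi> + laurent_eval q \<xi>"
proof -
  let ?S = "Poly_Mapping.keys p \<union> Poly_Mapping.keys q"
  show ?thesis
    using Poly_Mapping.keys_add[of p q]
    by (subst (1 2 3) laurent_eval_superset[where S = ?S])
       (auto simp: lookup_add algebra_simps sum.distrib)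
qed

lemma laurent_eval_single: "laurent_eval (Poly_Mapping.single \<alpha> c) \<xi> = c * lmono \<alpha> \<xi>"
  by (subst laurent_eval_superset[where S = "{\<alpha>}"]) auto

lemma laurent_eval_sum: "laurent_eval (\<Sum>x\<in>A. p x) \<xi> = (\<Sum>x\<in>A. laurent_eval (p x) \<xi>)"
  by (induction A rule: infinite_finite_induct) (auto simp: laurent_eval_add laurent_eval_def[of 0])

definition gam :: "nat \<Rightarrow> real \<Rightarrow> real \<Rightarrow> complex" where
  "gam b x t = of_real (indicator {0<..} t * (t ^ b * exp (- (x * t))))"

lemma gam_integrable_1: "integrable lborel (gam b 1)"
proof -
  have "integrable lborel (\<lambda>t::real. indicator {0<..} t * (t ^ b * exp (- (1 * t))))"
  proof (rule integrableI_nonneg)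
    have "(\<integral>\<^sup>+ t. ennreal (indicator {0<..} t * (t ^ b * exp (- (1 * t)))) \<partial>lborel)
        = (\<integral>\<^sup>+ t. ennreal (indicator {0..} t * t powr (real (Suc b) - 1) / exp t) \<partial>lborel)"
    proof (rule nn_integral_cong_AE)
      show "AE t in lborel. ennreal (indicator {0<..} t * (t ^ b * exp (- (1 * t))))
          = ennreal (indicator {0..} t * t powr (real (Suc b) - 1) / exp t)"
        using AE_lborel_singleton[of "0::real"]
        by eventually_elim
           (auto simp: indicator_def powr_realpow exp_minus field_simps)
    qed
    also have "\<dots> = Gamma (real (Suc b))"
      using Gamma_conv_nn_integral_real[of "real (Suc b)"] by simp
    also have "\<dots> < \<infinity>" by simp
    finally show "(\<integral>\<^sup>+ t. ennreal (indicator {0<..} t * (t ^ b * exp (- (1 * t)))) \<partial>lborel) < \<infinity>" .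
  qed (auto simp: indicator_def)
  then have "integrable lborel
      (\<lambda>t. complex_of_real (indicator {0<..} t * (t ^ b * exp (- (1 * t)))))"
    by (rule integrable_of_real)
  then show ?thesis by (simp only: gam_def[abs_def])
qed

lemma gam_scale: "x > 0 \<Longrightarrow> gam b x t = of_real (inverse x ^ b) * gam b 1 (0 + x * t)"
  by (auto simp: gam_def indicator_def zero_less_mult_iff field_simps)

lemma gam_integrable: assumes "x > 0" shows "integrable lborel (gam b x)"
proof -
  have "integrable lborel (\<lambda>t. of_real (inverse x ^ b) * gam b 1 (0 + x * t))"
    using assms gam_integrable_1
    by (intro integrable_mult_right lborel_integrable_real_affine) auto
  then show ?thesis using gam_scale[OF assms, of b] by presburger
qed

lemma gam_integral:
  assumes "x > 0"
  shows "(LINT t|lborel. gam b x t) = of_real (inverse x ^ Suc b) * (LINT t|lborel. gam b 1 t)"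
proof -
  have "(LINT t|lborel. gam b x t) = of_real (inverse x ^ b) * (LINT t|lborel. gam b 1 (0 + x * t))"
    by (simp only: gam_scale[OF assms, of b] integral_mult_right_zero)
  also have "(LINT t|lborel. gam b 1 (0 + x * t)) = of_real (inverse x) * (LINT t|lborel. gam b 1 t)"
    using lborel_integral_real_affine[of x "gam b 1" 0] assms
    by (simp add: scaleR_conv_of_real field_simps)
  finally show ?thesis by (simp add: mult_ac)
qed

lemma
  fixes h :: "'n::finite \<Rightarrow> real \<Rightarrow> complex"
  assumes int: "\<And>i. integrable lborel (h i)"
  shows integrable_vec_prod: "integrable lborel (\<lambda>z::real^'n. \<Prod>i\<in>UNIV. h i (z $ i))"
    and integral_vec_prod:
      "(LINT z|lborel. (\<Prod>i\<in>UNIV. h i (z $ i))) = (\<Prod>i\<in>UNIV. LINT t|lborel. h i t)"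
proof -
  interpret product_sigma_finite "\<lambda>_::real^'n. lborel :: real measure" ..
  define ix where "ix = (\<lambda>b::real^'n. SOME i. b = axis i (1::real))"
  have ix: "ix (axis i 1) = i" for i
    unfolding ix_def by (rule some_equality) (auto simp: axis_eq_axis)
  have B: "(\<Prod>b\<in>Basis. F (ix b)) = (\<Prod>i\<in>UNIV. F i)" for F :: "'n \<Rightarrow> complex"
  proof -
    have *: "(Basis :: (real^'n) set) = (\<lambda>i. axis i 1) ` UNIV"
      by (auto simp: Basis_vec_def)
    have "inj (\<lambda>i::'n. axis i (1::real))" by (auto simp: inj_on_def axis_eq_axis)
    then show ?thesis unfolding * by (simp add: prod.reindex ix)
  qed
  let ?T = "\<lambda>f. \<Sum>b\<in>(Basis :: (real^'n) set). f b *\<^sub>R b"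
  have mT: "?T \<in> measurable (\<Pi>\<^sub>M b\<in>Basis. lborel) borel"
    by measurable
  have mh: "(\<lambda>z::real^'n. \<Prod>i\<in>UNIV. h i (z $ i)) \<in> borel_measurable borel"
  proof -
    have "h i \<in> borel_measurable borel" for i
      using borel_measurable_integrable[OF int[of i]] by simp
    moreover have "(\<lambda>z::real^'n. z $ i) \<in> borel_measurable borel" for i
      by (intro borel_measurable_continuous_onI continuous_intros)
    ultimately have "(\<lambda>z::real^'n. h i (z $ i)) \<in> borel_measurable borel" for i
      by (rule measurable_compose[rotated])
    then show ?thesis by (intro borel_measurable_prod)
  qed
  have T: "(\<Prod>i\<in>UNIV. h i (?T f $ i)) = (\<Prod>b\<in>Basis. h (ix b) (f b))" for f
  proof -
    have "?T f $ i = f (axis i 1)" for i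
    proof -
      have "?T f $ i = ?T f \<bullet> axis i 1" by (simp add: inner_axis)
      also have "\<dots> = f (axis i 1)"
        by (rule inner_sum_left_Basis) (auto simp: Basis_vec_def)
      finally show ?thesis .
    qed
    then have "(\<Prod>i\<in>UNIV. h i (?T f $ i)) = (\<Prod>i\<in>UNIV. h i (f (axis i 1)))" by simp
    also have "\<dots> = (\<Prod>b\<in>Basis. h (ix b) (f (axis (ix b) 1)))" by (rule B[symmetric])
    also have "\<dots> = (\<Prod>b\<in>Basis. h (ix b) (f b))"
      by (intro prod.cong) (auto simp: Basis_vec_def ix)
    finally show ?thesis .
  qed
  have "integrable (\<Pi>\<^sub>M b\<in>Basis. lborel) (\<lambda>f. \<Prod>b\<in>(Basis :: (real^'n) set). h (ix b) (f b))"
    by (rule product_integrable_prod) (auto intro: int)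
  then show "integrable lborel (\<lambda>z::real^'n. \<Prod>i\<in>UNIV. h i (z $ i))"
    by (subst lborel_eq, subst integrable_distr_eq[OF mT mh]) (simp only: T)
  have "(LINT z|lborel. (\<Prod>i\<in>UNIV. h i (z $ i)))
      = (LINT f|(\<Pi>\<^sub>M b\<in>Basis. lborel). (\<Prod>b\<in>(Basis :: (real^'n) set). h (ix b) (f b)))"
    by (subst lborel_eq, subst integral_distr[OF mT mh]) (simp only: T)
  also have "\<dots> = (\<Prod>b\<in>(Basis :: (real^'n) set). LINT t|lborel. h (ix b) t)"
    by (rule product_integral_prod) (auto intro: int)
  also have "\<dots> = (\<Prod>i\<in>UNIV. LINT t|lborel. h i t)" by (rule B)
  finally show "(LINT z|lborel. (\<Prod>i\<in>UNIV. h i (z $ i))) = (\<Prod>i\<in>UNIV. LINT t|lborel. h i t)" .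
qed

lemma xz_monomial_eval:
  fixes m :: "('n::finite) var \<Rightarrow>\<^sub>0 nat"
  shows "(\<Prod>v\<in>Poly_Mapping.keys m. xz_point \<xi> z v ^ Poly_Mapping.lookup m v)
       = (\<Prod>i\<in>UNIV. of_real (\<xi> $ i) ^ Poly_Mapping.lookup m (Xi i))
         * (\<Prod>i\<in>UNIV. of_real (z $ i) ^ Poly_Mapping.lookup m (Zv i))"
proof -
  have U: "(UNIV :: 'n var set) = range Xi \<union> range Zv"
    proof (rule UNIV_eq_I)
    fix v :: "'n var"
    show "v \<in> range Xi \<union> range Zv" by (cases v) auto
  qed
  have fin: "finite (UNIV :: 'n var set)" unfolding U by simp
  have "(\<Prod>v\<in>Poly_Mapping.keys m. xz_point \<xi> z v ^ Poly_Mapping.lookup m v)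
      = (\<Prod>v\<in>UNIV. xz_point \<xi> z v ^ Poly_Mapping.lookup m v)"
    by (rule prod.mono_neutral_left) (auto simp: fin in_keys_iff)
  also have "\<dots> = (\<Prod>v\<in>range Xi. xz_point \<xi> z v ^ Poly_Mapping.lookup m v)
      * (\<Prod>v\<in>range Zv. xz_point \<xi> z v ^ Poly_Mapping.lookup m v)"
    unfolding U by (rule prod.union_disjoint) auto
  finally show ?thesis
    by (simp add: prod.reindex inj_on_def xz_point_def)
qed

lemma laplace_monomial:
  fixes m :: "('n::finite) var \<Rightarrow>\<^sub>0 nat"
  assumes x: "\<xi> \<in> pos_orthant"
  defines "F \<equiv> \<lambda>z::real^'n. indicator pos_orthant z *\<^sub>R
      ((\<Prod>v\<in>Poly_Mapping.keys m. xz_point \<xi> z v ^ Poly_Mapping.lookup m v)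
        * of_real (exp (- (\<xi> \<bullet> z))))"
  shows "integrable lborel F"
    and "integral\<^sup>L lborel F
       = (\<Prod>i\<in>UNIV. LINT t|lborel. gam (Poly_Mapping.lookup m (Zv i)) 1 t)
         * lmono (Abs_poly_mapping (\<lambda>i. int (Poly_Mapping.lookup m (Xi i))
                    - int (Poly_Mapping.lookup m (Zv i)) - 1)) \<xi>"
proof -
  have p: "\<xi> $ i > 0" for i using x by (simp add: pos_orthant_def)
  define A where "A = (\<Prod>i\<in>UNIV. complex_of_real (\<xi> $ i) ^ Poly_Mapping.lookup m (Xi i))"
  have F: "F = (\<lambda>z. A * (\<Prod>i\<in>UNIV. gam (Poly_Mapping.lookup m (Zv i)) (\<xi> $ i) (z $ i)))"
  proof
    fix z :: "real^'n"
    have I: "indicator pos_orthant z = (\<Prod>i\<in>UNIV. indicator {0<..} (z $ i) :: real)"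
      by (auto simp: indicator_def pos_orthant_def prod_zero_iff not_less)
    have E: "exp (- (\<xi> \<bullet> z)) = (\<Prod>i\<in>UNIV. exp (- (\<xi> $ i * z $ i)))"
      by (simp add: inner_vec_def exp_sum sum_negf[symmetric])
    show "F z = A * (\<Prod>i\<in>UNIV. gam (Poly_Mapping.lookup m (Zv i)) (\<xi> $ i) (z $ i))"
      unfolding F_def xz_monomial_eval A_def[symmetric] I E gam_def
      by (simp add: scaleR_conv_of_real prod.distrib)
  qed
  show "integrable lborel F"
    unfolding F by (intro integrable_mult_right integrable_vec_prod gam_integrable p)
  have "integral\<^sup>L lborel F = A * (\<Prod>i\<in>UNIV. LINT t|lborel. gam (Poly_Mapping.lookup m (Zv i)) (\<xi> $ i) t)"
    unfolding F integral_mult_right_zero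
    using integral_vec_prod[where h = "\<lambda>i. gam (Poly_Mapping.lookup m (Zv i)) (\<xi> $ i)", OF gam_integrable[OF p]]
    by (simp only:)
  also have "\<dots> = (\<Prod>i\<in>UNIV. LINT t|lborel. gam (Poly_Mapping.lookup m (Zv i)) 1 t)
      * (\<Prod>i\<in>UNIV. complex_of_real (\<xi> $ i) ^ Poly_Mapping.lookup m (Xi i)
           * of_real (inverse (\<xi> $ i) ^ Suc (Poly_Mapping.lookup m (Zv i))))"
    proof -
    have "(LINT t|lborel. gam b (\<xi> $ i) t)
        = (LINT t|lborel. gam b 1 t) * of_real (inverse (\<xi> $ i) ^ Suc b)" for b i
      using gam_integral[OF p] by (simp only: mult.commute)
    then show ?thesis
      unfolding A_def by (simp only: prod.distrib mult.left_commute)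
  qed
  also have "(\<Prod>i\<in>UNIV. complex_of_real (\<xi> $ i) ^ Poly_Mapping.lookup m (Xi i)
           * of_real (inverse (\<xi> $ i) ^ Suc (Poly_Mapping.lookup m (Zv i))))
      = lmono (Abs_poly_mapping (\<lambda>i. int (Poly_Mapping.lookup m (Xi i))
                    - int (Poly_Mapping.lookup m (Zv i)) - 1)) \<xi>"
    unfolding lmono_def
  proof (intro prod.cong refl)
    fix i :: 'n
    let ?a = "Poly_Mapping.lookup m (Xi i)" and ?b = "Poly_Mapping.lookup m (Zv i)"
    have "complex_of_real (\<xi> $ i) powi (int ?a - int (Suc ?b))
        = of_real (\<xi> $ i) ^ ?a * of_real (inverse (\<xi> $ i) ^ Suc ?b)"
      using p[of i] by (subst power_int_diff)
         (auto simp del: of_nat_Suc power_Suc simp: field_simps power_inverse)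
    moreover have "int ?a - int (Suc ?b) = int ?a - int ?b - 1" by simp
    ultimately show "complex_of_real (\<xi> $ i) ^ ?a * of_real (inverse (\<xi> $ i) ^ Suc ?b)
       = of_real (\<xi> $ i) powi Poly_Mapping.lookup (Abs_poly_mapping (\<lambda>i.
             int (Poly_Mapping.lookup m (Xi i)) - int (Poly_Mapping.lookup m (Zv i)) - 1)) i"
      by (subst lookup_Abs_poly_mapping) (simp, simp only:)
  qed
  finally show "integral\<^sup>L lborel F
       = (\<Prod>i\<in>UNIV. LINT t|lborel. gam (Poly_Mapping.lookup m (Zv i)) 1 t)
         * lmono (Abs_poly_mapping (\<lambda>i. int (Poly_Mapping.lookup m (Xi i))
                    - int (Poly_Mapping.lookup m (Zv i)) - 1)) \<xi>" .
qed

lemma ex1_laplace_laurent: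
  fixes f :: "('n::finite) xz_poly"
  shows "\<exists>!p. \<forall>\<xi>\<in>pos_orthant. laurent_eval p \<xi> = laplace f \<xi>"
proof -
  define p where "p = (\<Sum>m\<in>Poly_Mapping.keys f. Poly_Mapping.single
      (Abs_poly_mapping (\<lambda>i. int (Poly_Mapping.lookup m (Xi i)) - int (Poly_Mapping.lookup m (Zv i)) - 1))
      (Poly_Mapping.lookup f m * (\<Prod>i\<in>UNIV. LINT t|lborel. gam (Poly_Mapping.lookup m (Zv i)) 1 t)))"
  have p: "laurent_eval p \<xi> = laplace f \<xi>" if x: "\<xi> \<in> pos_orthant" for \<xi>
  proof -
    have "laplace f \<xi> = (LINT z|lborel. (\<Sum>m\<in>Poly_Mapping.keys f. Poly_Mapping.lookup f m *
        (indicator pos_orthant z *\<^sub>R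
          ((\<Prod>v\<in>Poly_Mapping.keys m. xz_point \<xi> z v ^ Poly_Mapping.lookup m v)
            * of_real (exp (- (\<xi> \<bullet> z)))))))"
      unfolding laplace_def set_lebesgue_integral_def poly_eval_def
      by (intro Bochner_Integration.integral_cong refl)
         (simp add: sum_distrib_left sum_distrib_right mult_ac scaleR_conv_of_real)
    also have "\<dots> = (\<Sum>m\<in>Poly_Mapping.keys f. Poly_Mapping.lookup f m *
        (LINT z|lborel. indicator pos_orthant z *\<^sub>R
          ((\<Prod>v\<in>Poly_Mapping.keys m. xz_point \<xi> z v ^ Poly_Mapping.lookup m v)
            * of_real (exp (- (\<xi> \<bullet> z))))))"
      by (subst Bochner_Integration.integral_sum)
         (simp_all only: integral_mult_right_zero integrable_mult_right laplace_monomial(1)[OF x])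
    also have "\<dots> = laurent_eval p \<xi>"
      unfolding p_def laurent_eval_sum laurent_eval_single
      by (simp only: laplace_monomial(2)[OF x] mult.assoc)
    finally show ?thesis by simp
  qed
  show ?thesis
  proof (rule ex1I[of _ p])
    show "\<forall>\<xi>\<in>pos_orthant. laurent_eval p \<xi> = laplace f \<xi>" using p by blast
    fix q assume "\<forall>\<xi>\<in>pos_orthant. laurent_eval q \<xi> = laplace f \<xi>"
    then show "q = p" by (intro laurent_eval_eqD) (simp add: p)
  qed
qed

end

theory Submission
  imports Defs
begin

text \<open>
  On monomials the Laplace transform is \<open>\<xi>\<^sup>a z\<^sup>b \<mapsto> b! \<xi>\<^bsup>a-b-1\<^esup>\<close>, where \<open>b! = \<Prod>\<^sub>i b\<^sub>i!\<close> and \<open>1\<close> stands for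
  \<open>(1,\<dots>,1)\<close>.

  If \<open>b\<^sub>i > 0\<close>, then both terms of \<open>\<Theta>\<^sub>i (\<xi>\<^sup>a z\<^sup>b)\<close> have the same transform.  If \<open>b\<^sub>i = 0\<close>, then the
  derivative vanishes and the transform of \<open>\<xi>\<^sub>i \<xi>\<^sup>a z\<^sup>b\<close> has \<open>i\<close>-th exponent \<open>a\<^sub>i \<ge> 0\<close>.  In both cases
  the transform has no negative part, which is the forward implication
  (\<open>negative_part_laplace_poly_Theta\<close>).

  Conversely, multiplication by \<open>\<xi>\<^sub>i\<close> acts as \<open>\<partial>\<^sub>i\<close> modulo \<open>Im \<Theta>\<close>, so every polynomial is congruent to
  one in \<open>z\<close> alone.  A monomial \<open>z\<^sup>b\<close> has the transform \<open>b! \<xi>\<^bsup>-b-1\<^esup>\<close>, so on polynomials in \<open>z\<close> the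
  transform is injective with image the negative Laurent polynomials.  With \<open>negative_lift\<close> the inverse
  map, applied to the negative part, this says that \<open>f\<close> is congruent to
  \<open>negative_lift (laplace_poly f)\<close> modulo \<open>Im \<Theta>\<close> (\<open>diff_negative_lift_in_Im_Theta\<close>); when the
  negative part of the transform is zero, the lift is zero and \<open>f\<close> lies in \<open>Im \<Theta>\<close>.
\<close>

section \<open>Additive maps on finitely supported functions\<close>

lemma poly_mapping_additive_induct [case_names zero single add]:
  fixes f :: "'a \<Rightarrow>\<^sub>0 'b::comm_monoid_add"
  assumes zero: "P 0"
    and single: "\<And>m c. P (Poly_Mapping.single m c)"
    and add: "\<And>f g. P f \<Longrightarrow> P g \<Longrightarrow> P (f + g)"
  shows "P f"
proof -
  have "P (\<Sum>m\<in>A. Poly_Mapping.single m (Poly_Mapping.lookup f m))" if "finite A" for A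
    using that by (induction A rule: finite_induct) (auto intro: zero single add)
  moreover have "(\<Sum>m\<in>Poly_Mapping.keys f. Poly_Mapping.single m (Poly_Mapping.lookup f m)) = f"
    by (intro poly_mapping_eqI)
       (auto simp: lookup_sum lookup_single when_def in_keys_iff sum.delta)
  ultimately show ?thesis
    by (metis finite_keys)
qed

section \<open>The operators \<open>\<Theta>\<^sub>i\<close> and their image\<close>

lemma partial_deriv_add: "partial_deriv v (p + q) = partial_deriv v p + partial_deriv v q"
  unfolding partial_deriv_def
  by (rule setsum_keys_plus_distrib) (simp_all add: single_add distrib_left)

lemma partial_deriv_zero [simp]: "partial_deriv v 0 = 0"
  by (simp add: partial_deriv_def)

lemma partial_deriv_single:
  "partial_deriv v (Poly_Mapping.single m c) =
     Poly_Mapping.single (m - Poly_Mapping.single v 1) (of_nat (Poly_Mapping.lookup m v) * c)"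
  by (simp add: partial_deriv_def)

lemma Theta_add: "Theta i (p + q) = Theta i p + Theta i q"
  by (simp add: Theta_def partial_deriv_add algebra_simps)

lemma Theta_zero [simp]: "Theta i 0 = 0"
  by (simp add: Theta_def)

lemma Theta_single:
  "Theta i (Poly_Mapping.single m c) =
     Poly_Mapping.single (m + Poly_Mapping.single (Xi i) 1) c
     - Poly_Mapping.single (m - Poly_Mapping.single (Zv i) 1)
         (of_nat (Poly_Mapping.lookup m (Zv i)) * c)"
  by (simp add: Theta_def xz_var_def mult_single partial_deriv_single add.commute)

lemma Im_Theta_zero: "0 \<in> Im_Theta"
  unfolding Im_Theta_def by (auto intro!: exI[of _ "\<lambda>_. 0"])

lemma Im_Theta_add:
  assumes "f \<in> Im_Theta" "g \<in> Im_Theta"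
  shows "f + g \<in> Im_Theta"
proof -
  from assms obtain u v where "f = (\<Sum>i\<in>UNIV. Theta i (u i))" "g = (\<Sum>i\<in>UNIV. Theta i (v i))"
    unfolding Im_Theta_def by blast
  then have "f + g = (\<Sum>i\<in>UNIV. Theta i (u i + v i))"
    by (simp add: Theta_add sum.distrib)
  then show ?thesis
    unfolding Im_Theta_def by (auto intro!: exI[of _ "\<lambda>i. u i + v i"])
qed

lemma Theta_in_Im_Theta: "Theta i g \<in> Im_Theta"
proof -
  have "(\<Sum>j\<in>UNIV. Theta j (if j = i then g else 0)) = (\<Sum>j\<in>UNIV. if j = i then Theta i g else 0)"
    by (intro sum.cong) auto
  also have "\<dots> = Theta i g"
    by simp
  finally show ?thesis
    unfolding Im_Theta_def by (auto intro!: exI[of _ "\<lambda>j. if j = i then g else 0"])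
qed

section \<open>An explicit formula for the Laplace transform\<close>

text \<open>The exponent \<open>a - b - 1\<close> of the Laplace transform of \<open>\<xi>\<^sup>a z\<^sup>b\<close>.\<close>

definition laplace_exponent :: "('n::finite var \<Rightarrow>\<^sub>0 nat) \<Rightarrow> ('n \<Rightarrow>\<^sub>0 int)" where
  "laplace_exponent m = Abs_poly_mapping
     (\<lambda>i. int (Poly_Mapping.lookup m (Xi i)) - int (Poly_Mapping.lookup m (Zv i)) - 1)"

text \<open>The coefficient \<open>b!\<close> of the Laplace transform of \<open>\<xi>\<^sup>a z\<^sup>b\<close>.\<close>

definition z_factorial :: "('n::finite var \<Rightarrow>\<^sub>0 nat) \<Rightarrow> complex" where
  "z_factorial m = (\<Prod>i\<in>UNIV. fact (Poly_Mapping.lookup m (Zv i)))"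

text \<open>The Laplace transform as the linear extension of \<open>\<xi>\<^sup>a z\<^sup>b \<mapsto> b! \<xi>\<^bsup>a-b-1\<^esup>\<close>.\<close>

definition laplace_poly :: "('n::finite) xz_poly \<Rightarrow> 'n laurent_poly" where
  "laplace_poly f = (\<Sum>m\<in>Poly_Mapping.keys f.
     Poly_Mapping.single (laplace_exponent m) (Poly_Mapping.lookup f m * z_factorial m))"

lemma lookup_laplace_exponent [simp]:
  "Poly_Mapping.lookup (laplace_exponent m) i =
     int (Poly_Mapping.lookup m (Xi i)) - int (Poly_Mapping.lookup m (Zv i)) - 1"
  unfolding laplace_exponent_def by (subst lookup_Abs_poly_mapping) auto

lemma z_factorial_nonzero [simp]: "z_factorial m \<noteq> 0"
  by (simp add: z_factorial_def)

lemma laplace_poly_add: "laplace_poly (f + g) = laplace_poly f + laplace_poly g"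
  unfolding laplace_poly_def
  by (rule setsum_keys_plus_distrib) (simp_all add: single_add distrib_right)

lemma laplace_poly_zero [simp]: "laplace_poly 0 = 0"
  by (simp add: laplace_poly_def)

lemma laplace_poly_diff: "laplace_poly (f - g) = laplace_poly f - laplace_poly g"
  using laplace_poly_add[of "f - g" g] by simp

lemma laplace_poly_single:
  "laplace_poly (Poly_Mapping.single m c) =
     Poly_Mapping.single (laplace_exponent m) (c * z_factorial m)"
  by (simp add: laplace_poly_def)

lemma gam_integral_one: "(LINT t|lborel. gam b 1 t) = fact b"
proof -
  have "(LINT t|lborel. indicator {0<..} t * (t ^ b * exp (- (1 * t)))) = (fact b :: real)"
  proof (rule integral_eq_nn_integral[THEN trans])
    have "(\<integral>\<^sup>+ t. ennreal (indicator {0<..} t * (t ^ b * exp (- (1 * t)))) \<partial>lborel)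
        = (\<integral>\<^sup>+ t. ennreal (indicator {0..} t * t powr (real (Suc b) - 1) / exp t) \<partial>lborel)"
    proof (rule nn_integral_cong_AE)
      show "AE t in lborel. ennreal (indicator {0<..} t * (t ^ b * exp (- (1 * t))))
          = ennreal (indicator {0..} t * t powr (real (Suc b) - 1) / exp t)"
        using AE_lborel_singleton[of "0::real"]
        by eventually_elim (auto simp: indicator_def powr_realpow exp_minus field_simps)
    qed
    also have "\<dots> = Gamma (real (Suc b))"
      using Gamma_conv_nn_integral_real[of "real (Suc b)"] by simp
    also have "\<dots> = ennreal (fact b)"
      using Gamma_fact[of b, where 'a = real] by (simp add: add.commute)
    finally show "enn2real (\<integral>\<^sup>+ t. ennreal (indicator {0<..} t * (t ^ b * exp (- (1 * t)))) \<partial>lborel)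
        = fact b"
      by simp
  qed (auto simp: indicator_def)
  then show ?thesis
    unfolding gam_def by (simp only: integral_complex_of_real of_real_fact)
qed

lemma laurent_eval_laplace_poly:
  assumes x: "\<xi> \<in> pos_orthant"
  shows "laurent_eval (laplace_poly f) \<xi> = laplace f \<xi>"
proof -
  define F where "F = (\<lambda>m z. indicator pos_orthant z *\<^sub>R
    ((\<Prod>v\<in>Poly_Mapping.keys m. xz_point \<xi> z v ^ Poly_Mapping.lookup m v)
      * complex_of_real (exp (- (\<xi> \<bullet> z)))))"
  have int: "integrable lborel (F m)"
    and val: "integral\<^sup>L lborel (F m) = z_factorial m * lmono (laplace_exponent m) \<xi>" for m
    using laplace_monomial[OF x, of m]
    unfolding F_def by (simp_all only: gam_integral_one z_factorial_def laplace_exponent_def)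
  have "laplace f \<xi> = (LINT z|lborel. (\<Sum>m\<in>Poly_Mapping.keys f. Poly_Mapping.lookup f m * F m z))"
    unfolding laplace_def set_lebesgue_integral_def poly_eval_def F_def
    by (intro Bochner_Integration.integral_cong refl)
       (simp add: sum_distrib_left sum_distrib_right mult_ac scaleR_conv_of_real)
  also have "\<dots> = (\<Sum>m\<in>Poly_Mapping.keys f. Poly_Mapping.lookup f m * integral\<^sup>L lborel (F m))"
    by (subst Bochner_Integration.integral_sum)
       (simp_all only: integral_mult_right_zero integrable_mult_right int)
  also have "\<dots> = laurent_eval (laplace_poly f) \<xi>"
    by (simp add: laplace_poly_def laurent_eval_sum laurent_eval_single val mult.assoc)
  finally show ?thesis by simp
qed

lemma laplace_laurent_eq_laplace_poly: "laplace_laurent f = laplace_poly f"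
  unfolding laplace_laurent_def
  by (rule the1_equality[OF ex1_laplace_laurent]) (simp add: laurent_eval_laplace_poly)

section \<open>Laplace transforms of the image of \<open>\<Theta>\<close>\<close>

lemma negative_part_zero_add:
  "negative_part_zero p \<Longrightarrow> negative_part_zero q \<Longrightarrow> negative_part_zero (p + q)"
  by (simp add: negative_part_zero_def lookup_add)

lemma negative_part_zero_zero [simp]: "negative_part_zero 0"
  by (simp add: negative_part_zero_def)

lemma negative_part_laplace_poly_Theta: "negative_part_zero (laplace_poly (Theta i g))"
proof (induction g rule: poly_mapping_additive_induct)
  case zero
  show ?case by simp
next
  case (add f g)
  then show ?case by (simp add: Theta_add laplace_poly_add negative_part_zero_add)
next
  case (single m c)
  let ?up = "m + Poly_Mapping.single (Xi i) 1"
  let ?down = "m - Poly_Mapping.single (Zv i) 1"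
  have up: "z_factorial ?up = z_factorial m"
    by (simp add: z_factorial_def lookup_add lookup_single)
  show ?case
  proof (cases "Poly_Mapping.lookup m (Zv i) = 0")
    case True
    then have "laplace_poly (Theta i (Poly_Mapping.single m c)) =
        Poly_Mapping.single (laplace_exponent ?up) (c * z_factorial m)"
      by (simp add: Theta_single laplace_poly_single up[simplified])
    moreover have "Poly_Mapping.lookup (laplace_exponent ?up) i \<ge> 0"
      using True by (simp add: lookup_add lookup_single)
    ultimately show ?thesis
      by (auto simp: negative_part_zero_def lookup_single when_def not_le dest: spec[of _ i])
  next
    case False
    have "laplace_exponent ?up = laplace_exponent ?down"
      using False
      by (intro poly_mapping_eqI) (auto simp: lookup_add lookup_minus lookup_single when_def)
    moreover have "z_factorial m = of_nat (Poly_Mapping.lookup m (Zv i)) * z_factorial ?down"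
    proof -
      have "z_factorial m = fact (Poly_Mapping.lookup m (Zv i))
          * (\<Prod>j\<in>UNIV - {i}. fact (Poly_Mapping.lookup m (Zv j)))"
        unfolding z_factorial_def by (subst prod.remove[of _ i]) auto
      moreover have "z_factorial ?down = fact (Poly_Mapping.lookup m (Zv i) - 1)
          * (\<Prod>j\<in>UNIV - {i}. fact (Poly_Mapping.lookup m (Zv j)))"
        unfolding z_factorial_def
        by (subst prod.remove[of _ i])
           (auto simp: lookup_minus lookup_single when_def intro!: prod.cong)
      ultimately show ?thesis
        using False fact_reduce[of "Poly_Mapping.lookup m (Zv i)", where 'a = complex] by simp
    qed
    ultimately have "laplace_poly (Theta i (Poly_Mapping.single m c)) = 0"
      unfolding Theta_single laplace_poly_diff laplace_poly_single up
      by (simp add: mult_ac)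
    then show ?thesis by simp
  qed
qed

lemma negative_part_laplace_poly_Im_Theta:
  assumes "f \<in> Im_Theta"
  shows "negative_part_zero (laplace_poly f)"
proof -
  from assms obtain g where f: "f = (\<Sum>i\<in>UNIV. Theta i (g i))"
    unfolding Im_Theta_def by blast
  have "negative_part_zero (laplace_poly (\<Sum>i\<in>A. Theta i (g i)))" if "finite A" for A
    using that
    by (induction A rule: finite_induct)
       (auto simp: laplace_poly_add negative_part_laplace_poly_Theta negative_part_zero_add)
  then show ?thesis unfolding f by simp
qed

section \<open>Reduction to polynomials in \<open>z\<close> modulo the image of \<open>\<Theta>\<close>\<close>

text \<open>
  The exponent of \<open>z\<^bsup>-\<alpha>-1\<^esup>\<close>, the monomial in \<open>z\<close> alone whose transform is a multiple of \<open>\<xi>\<^sup>\<alpha>\<close>.  It is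
  meaningful only if all components of \<open>\<alpha>\<close> are at most \<open>-1\<close>.
\<close>

definition z_exponent :: "('n::finite \<Rightarrow>\<^sub>0 int) \<Rightarrow> ('n var \<Rightarrow>\<^sub>0 nat)" where
  "z_exponent \<alpha> = Abs_poly_mapping
     (\<lambda>v. case v of Xi i \<Rightarrow> 0 | Zv i \<Rightarrow> nat (- Poly_Mapping.lookup \<alpha> i - 1))"

text \<open>The linear map that sends \<open>\<xi>\<^bsup>-b-1\<^esup>\<close> to \<open>z\<^sup>b / b!\<close> and every other Laurent monomial to \<open>0\<close>.\<close>

definition negative_lift :: "('n::finite) laurent_poly \<Rightarrow> 'n xz_poly" where
  "negative_lift p = (\<Sum>\<alpha>\<in>Poly_Mapping.keys p.
     if \<forall>i. Poly_Mapping.lookup \<alpha> i \<le> -1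
     then Poly_Mapping.single (z_exponent \<alpha>) (Poly_Mapping.lookup p \<alpha> / z_factorial (z_exponent \<alpha>))
     else 0)"

lemma lookup_z_exponent:
  "Poly_Mapping.lookup (z_exponent \<alpha>) v =
     (case v of Xi i \<Rightarrow> 0 | Zv i \<Rightarrow> nat (- Poly_Mapping.lookup \<alpha> i - 1))"
proof -
  have "(UNIV :: 'a var set) = range Xi \<union> range Zv"
    by (rule UNIV_eq_I) (metis UnI1 UnI2 rangeI var.exhaust)
  then have "finite (UNIV :: 'a var set)"
    by (metis finite_UnI finite_imageI finite_code)
  then show ?thesis
    unfolding z_exponent_def
    by (subst lookup_Abs_poly_mapping) (auto intro: finite_subset[OF subset_UNIV])
qed

lemma z_exponent_laplace_exponent:
  assumes "\<And>i. Poly_Mapping.lookup m (Xi i) = 0"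
  shows "z_exponent (laplace_exponent m) = m"
  by (rule poly_mapping_eqI) (auto simp: lookup_z_exponent assms split: var.split)

lemma negative_lift_add: "negative_lift (p + q) = negative_lift p + negative_lift q"
  unfolding negative_lift_def
  by (rule setsum_keys_plus_distrib) (simp_all add: single_add add_divide_distrib)

lemma negative_lift_eq_zero: "negative_part_zero p \<Longrightarrow> negative_lift p = 0"
  unfolding negative_lift_def negative_part_zero_def by (auto intro!: sum.neutral)

lemma diff_negative_lift_single_in_Im_Theta:
  fixes m :: "('n::finite) var \<Rightarrow>\<^sub>0 nat"
  defines "residual \<equiv> \<lambda>f :: 'n xz_poly. f - negative_lift (laplace_poly f)"
  shows "residual (Poly_Mapping.single m c) \<in> Im_Theta"
  \<comment> \<open>Each step trades one factor \<open>\<xi>\<^sub>i\<close> for a \<open>\<partial>\<^sub>i\<close>, so the degree in \<open>\<xi>\<close> decreases.\<close>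
proof (induction "\<Sum>i\<in>UNIV. Poly_Mapping.lookup m (Xi i)" arbitrary: m c)
  case 0
  then have *: "Poly_Mapping.lookup m (Xi i) = 0" for i
    by simp
  have "residual (Poly_Mapping.single m c) = 0"
    by (simp add: residual_def laplace_poly_single negative_lift_def
          z_exponent_laplace_exponent * )
  then show ?case by (simp add: Im_Theta_zero)
next
  case (Suc d)
  then obtain i where i: "Poly_Mapping.lookup m (Xi i) \<noteq> 0"
    by (metis sum.neutral nat.distinct(1))
  define k where "k = m - Poly_Mapping.single (Xi i) 1"
  define l where "l = k - Poly_Mapping.single (Zv i) 1"
  \<comment> \<open>If \<open>z\<^sub>i\<close> does not occur, then \<open>l\<close> is truncated, but the coefficient \<open>b\<close> is \<open>0\<close>.\<close>
  define b :: complex where "b = of_nat (Poly_Mapping.lookup k (Zv i))"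
  have m: "m = k + Poly_Mapping.single (Xi i) 1"
    unfolding k_def using i
    by (intro poly_mapping_eqI) (auto simp: lookup_add lookup_minus lookup_single when_def)
  have "(\<Sum>j\<in>UNIV. Poly_Mapping.lookup m (Xi j))
      = (\<Sum>j\<in>UNIV. Poly_Mapping.lookup l (Xi j) + (if j = i then 1 else 0))"
    by (intro sum.cong) (auto simp: m l_def lookup_add lookup_minus lookup_single when_def)
  then have d: "d = (\<Sum>j\<in>UNIV. Poly_Mapping.lookup l (Xi j))"
    using Suc.hyps(2) by (simp add: sum.distrib)
  have residual_add: "residual (f + g) = residual f + residual g" for f g
    by (simp add: residual_def laplace_poly_add negative_lift_add)
  have residual_Theta: "residual (Theta i g) = Theta i g" for g
    by (simp add: residual_def negative_lift_eq_zero negative_part_laplace_poly_Theta)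
  have "Poly_Mapping.single m c = Theta i (Poly_Mapping.single k c) + Poly_Mapping.single l (b * c)"
    by (simp add: Theta_single m l_def b_def)
  then have "residual (Poly_Mapping.single m c) =
      Theta i (Poly_Mapping.single k c) + residual (Poly_Mapping.single l (b * c))"
    by (simp only: residual_add residual_Theta)
  then show ?case
    using Suc.hyps(1)[OF d] by (simp add: Im_Theta_add Theta_in_Im_Theta)
qed

lemma diff_negative_lift_in_Im_Theta: "f - negative_lift (laplace_poly f) \<in> Im_Theta"
proof (induction f rule: poly_mapping_additive_induct)
  case zero
  show ?case by (simp add: negative_lift_eq_zero Im_Theta_zero)
next
  case (single m c)
  show ?case by (rule diff_negative_lift_single_in_Im_Theta)
next
  case (add f g)
  then show ?case
    using Im_Theta_add[OF add] by (simp add: laplace_poly_add negative_lift_add add_diff_add)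
qed

theorem corollary3p10:
  fixes f :: "('n::finite) xz_poly"
  shows "f \<in> Im_Theta \<longleftrightarrow> negative_part_zero (laplace_laurent f)"
proof
  assume "f \<in> Im_Theta"
  then show "negative_part_zero (laplace_laurent f)"
    by (simp add: laplace_laurent_eq_laplace_poly negative_part_laplace_poly_Im_Theta)
next
  assume "negative_part_zero (laplace_laurent f)"
  then show "f \<in> Im_Theta"
    using diff_negative_lift_in_Im_Theta[of f]
    by (simp add: laplace_laurent_eq_laplace_poly negative_lift_eq_zero)
qed

end
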